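(* Let $S$ be a numerical semigroup with cyclotomic exponent sequence $\mathbf e$. Then $\mathrm U(\mathrm{Betti}(S))=\mathrm U(\mathcal E(S))$, where both $\mathrm{Betti}(S)$ and $\mathcal E(S)$ are partially ordered by $\le_S$. Moreover, for every $b\in\mathrm U(\mathrm{Betti}(S))$ one has $e_b=\mathrm{nc}(\nabla_b)-1$.
   Context: A numerical semigroup $S$ is a submonoid of $(\mathbb N,+)$, $\mathbb N=\{0,1,2,\dots\}$, with $\mathbb N\setminus S$ finite; it has a unique minimal generating set $A=\{n_1,\dots,n_e\}$ (the minimal generators). The semigroup polynomial is $\mathrm P_S(x)=(1-x)\sum_{s\in S}x^s$, and the cyclotomic exponent sequence $\mathbf e=(e_j)_{j\ge1}$ is the unique integer sequence with $\mathrm P_S(x)=\prod_{j\ge1}(1-x^j)^{e_j}$ in $\mathbb Z[[x]]$. Set $\mathcal E(S)=\{d\in\mathbb N: d\ge2,\ e_d\neq0,\ d\notin A\}$. For $a,b\in\mathbb Z$ write $a\le_S b$ if $b-a\in S$ (a partial order). Let $\varphi:\mathbb N^e\to S$, $\varphi(a)=\sum_i a_in_i$; $\mathrm Z(s)=\varphi^{-1}(s)$ is the set of factorizations of $s\in S$. The graph $\nabla_s$ has vertex set $\mathrm Z(s)$, with distinct $x,y$ adjacent iff $x\cdot y\neq0$ (usual dot product). Its connected components are the $R$-classes of $s$, and $\mathrm{nc}(\nabla_s)$ is their number. $s$ is a Betti element if $\nabla_s$ is disconnected; $\mathrm{Betti}(S)$ is the set of Betti elements. For a poset $(X,\le)$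 and $x\in X$ let $\downarrow x=\{y\in X: y\le x\}$, and $\mathrm U(X)=\{x\in X:\ \downarrow x\text{ is totally ordered}\}$. *)

theory Defs
  imports "HOL-Computational_Algebra.Formal_Power_Series"
begin

definition numerical_semigroup :: "nat set \<Rightarrow> bool" where
  "numerical_semigroup S \<longleftrightarrow> 0 \<in> S \<and> (\<forall>a\<in>S. \<forall>b\<in>S. a + b \<in> S) \<and> finite (UNIV - S)"

text \<open>Minimal generating set: nonzero elements not a sum of two nonzero elements.\<close>
definition min_gens :: "nat set \<Rightarrow> nat set" where
  "min_gens S = {n \<in> S. n \<noteq> 0 \<and> \<not> (\<exists>a\<in>S. \<exists>b\<in>S. a \<noteq> 0 \<and> b \<noteq> 0 \<and> n = a + b)}"

text \<open>Semigroup polynomial P_S(x) = (1 - x) * sum_{s in S} x^s, as an integer power series.\<close>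
definition semigroup_poly :: "nat set \<Rightarrow> int fps" where
  "semigroup_poly S = (1 - fps_X) * Abs_fps (\<lambda>n. if n \<in> S then 1 else 0)"

text \<open>e is a cyclotomic exponent sequence of S if P_S = prod_{j>=1} (1 - x^j)^(e_j) in Z[[x]].
  The infinite product converges x-adically; we express the identity coefficientwise via
  truncations, and clear the (unit) factors with negative exponents to the left-hand side.\<close>
definition is_cyc_exp :: "nat set \<Rightarrow> (nat \<Rightarrow> int) \<Rightarrow> bool" where
  "is_cyc_exp S e \<longleftrightarrow> e 0 = 0 \<and>
     (\<forall>N k. k \<le> N \<longrightarrow>
        fps_nth (semigroup_poly S * (\<Prod>j\<in>{j\<in>{1..N}. e j < 0}. (1 - fps_X ^ j) ^ nat (- e j))) k
      = fps_nth (\<Prod>j\<in>{j\<in>{1..N}. e j > 0}. (1 - fps_X ^ j) ^ nat (e j)) k)"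

definition cyc_exp :: "nat set \<Rightarrow> nat \<Rightarrow> int" where
  "cyc_exp S = (THE e. is_cyc_exp S e)"

definition calE :: "nat set \<Rightarrow> nat set" where
  "calE S = {d. d \<ge> 2 \<and> cyc_exp S d \<noteq> 0 \<and> d \<notin> min_gens S}"

definition le_S :: "nat set \<Rightarrow> int \<Rightarrow> int \<Rightarrow> bool" where
  "le_S S a b \<longleftrightarrow> b - a \<ge> 0 \<and> nat (b - a) \<in> S"

text \<open>Factorizations of s: vectors indexed by the minimal generators.\<close>
definition factorizations :: "nat set \<Rightarrow> nat \<Rightarrow> (nat \<Rightarrow> nat) set" where
  "factorizations S s = {a. (\<forall>n. n \<notin> min_gens S \<longrightarrow> a n = 0) \<and> (\<Sum>n\<in>min_gens S. a n * n) = s}"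

definition fact_adj :: "nat set \<Rightarrow> nat \<Rightarrow> ((nat \<Rightarrow> nat) \<times> (nat \<Rightarrow> nat)) set" where
  "fact_adj S s = {(x, y). x \<in> factorizations S s \<and> y \<in> factorizations S s \<and> x \<noteq> y \<and>
                      (\<Sum>n\<in>min_gens S. x n * y n) \<noteq> 0}"

text \<open>Connected components (R-classes) of nabla_s, and their number.\<close>
definition R_classes :: "nat set \<Rightarrow> nat \<Rightarrow> (nat \<Rightarrow> nat) set set" where
  "R_classes S s = factorizations S s // ((fact_adj S s)\<^sup>*)"

definition nc :: "nat set \<Rightarrow> nat \<Rightarrow> nat" where
  "nc S s = card (R_classes S s)"

definition Betti :: "nat set \<Rightarrow> nat set" where
  "Betti S = {s \<in> S. card (R_classes S s) \<ge> 2}"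

definition U_set :: "('a \<Rightarrow> 'a \<Rightarrow> bool) \<Rightarrow> 'a set \<Rightarrow> 'a set" where
  "U_set le X = {x \<in> X. \<forall>y\<in>X. \<forall>z\<in>X. le y x \<longrightarrow> le z x \<longrightarrow> le y z \<or> le z y}"

end

theory Submission
  imports Defs "HOL-Library.Function_Algebras"
begin

text \<open>
  Write \<open>K\<close> for the numerator \<open>\<Prod>\<^bsub>n \<in> A\<^esub> (1 - X\<^bsup>n\<^esup>) \<cdot> \<Sum>\<^bsub>s \<in> S\<^esub> X\<^bsup>s\<^esup>\<close> of the Hilbert series.
  Suppose that the Betti elements below \<open>s\<close> form a chain with least element \<open>b\<close>. Above \<open>b\<close>, the graph of
  a Betti element consists of isolated factorizations and one further component, and all isolated factorizations
  of Betti elements below \<open>s\<close> have pairwise disjoint supports. Discard one of them, a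
  factorization \<open>z\<close> of \<open>b\<close>, and let \<open>Y\<close> consist of the others; \<open>Y\<close> has \<open>nc t - 1\<close> members of each degree \<open>t\<close>.
  Every \<open>t\<close> below \<open>s\<close> in \<open>S\<close> has exactly one factorization that lies above no member of \<open>Y\<close>, because such a
  factorization of a \<open>t\<close> with several factorizations lies above \<open>z\<close>, which can be subtracted.
  Counting these normal forms by degree shows that \<open>K\<close> and \<open>\<Prod>\<^bsub>y \<in> Y\<^esub> (1 - X\<^bsup>deg y\<^esup>)\<close> have the same coefficients
  below \<open>s\<close>. Comparing logarithmic derivatives there gives the exponent of \<open>1 - X\<^bsup>s\<^esup>\<close> in \<open>K\<close>, namely \<open>nc s - 1\<close>.
  The equality of the two sets follows by well-founded induction along the order.
\<close>

unbundle fps_syntax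

section \<open>Products of power series and vanishing on a set of degrees\<close>

text \<open>Each term \<open>F $ i * B $ (n - i)\<close> has either \<open>i\<close> outside
  \<open>S\<close> or \<open>n - i\<close> in \<open>T\<close>. This allows computing modulo the
  series that vanish on \<open>T\<close>; the sets \<open>T\<close> used below are initial segments,
  the complement of \<open>S\<close>, and the numbers below a fixed \<open>s\<close>.\<close>

lemma fps_mult_vanish:
  fixes F B :: "'a::comm_ring_1 fps"
  assumes supp: "\<And>i. i \<notin> S \<Longrightarrow> F $ i = 0"
    and closed: "\<And>n i. n \<in> T \<Longrightarrow> i \<in> S \<Longrightarrow> i \<le> n \<Longrightarrow> n - i \<in> T"
    and B: "\<And>n. n \<in> T \<Longrightarrow> B $ n = 0" and "n \<in> T"
  shows "(F * B) $ n = 0"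
  unfolding fps_mult_nth
proof (rule sum.neutral, rule ballI)
  fix i assume "i \<in> {0..n}"
  then show "F $ i * B $ (n - i) = 0"
    using assms by (cases "i \<in> S") auto
qed

text \<open>The division counterpart: since \<open>F $ 0 = 1\<close>, the coefficient
  \<open>B $ n\<close> is \<open>(F * B) $ n\<close> minus terms with \<open>B\<close> at smaller
  degrees, which lie in \<open>T\<close> or have a zero factor.\<close>

lemma fps_cancel_vanish:
  fixes F B :: "'a::comm_ring_1 fps"
  assumes supp: "\<And>i. i \<notin> S \<Longrightarrow> F $ i = 0" and F0: "F $ 0 = 1"
    and closed: "\<And>n i. n \<in> T \<Longrightarrow> i \<in> S \<Longrightarrow> i \<le> n \<Longrightarrow> n - i \<in> T"
    and FB: "\<And>n. n \<in> T \<Longrightarrow> (F * B) $ n = 0" and "n \<in> T"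
  shows "B $ n = 0"
  using \<open>n \<in> T\<close>
proof (induction n rule: less_induct)
  case (less n)
  have z: "F $ i * B $ (n - i) = 0" if "i \<in> {0<..n}" for i
    using that less closed[of n i] supp[of i] by (cases "i \<in> S") auto
  have "(F * B) $ n = F $ 0 * B $ n + (\<Sum>i\<in>{0<..n}. F $ i * B $ (n - i))"
    unfolding fps_mult_nth by (simp add: sum.head)
  also have "\<dots> = B $ n"
    using z by (simp add: F0)
  finally show ?case
    using FB less.prems by simp
qed

text \<open>The complement of a set closed under addition is stable under subtracting elements of
  the set, so it can serve as \<open>T\<close>.\<close>

lemma fps_mult_supported:
  fixes F G :: "'a::comm_ring_1 fps"
  assumes "\<And>a b. a \<in> S \<Longrightarrow> b \<in> S \<Longrightarrow> a + b \<in> S"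
    and "\<And>i. i \<notin> S \<Longrightarrow> F $ i = 0" "\<And>i. i \<notin> S \<Longrightarrow> G $ i = 0" "n \<notin> S"
  shows "(F * G) $ n = 0"
proof (rule fps_mult_vanish[where S = S and T = "- S"])
  show "k - i \<in> - S" if "k \<in> - S" "i \<in> S" "i \<le> k" for k i
    using assms(1)[of "k - i" i] that by auto
qed (use assms in auto)

lemma fps_prod_supported:
  fixes F :: "'b \<Rightarrow> 'a::comm_ring_1 fps"
  assumes "0 \<in> S" and "\<And>a b. a \<in> S \<Longrightarrow> b \<in> S \<Longrightarrow> a + b \<in> S"
    and "\<And>j i. j \<in> I \<Longrightarrow> i \<notin> S \<Longrightarrow> F j $ i = 0" "n \<notin> S"
  shows "(\<Prod>j\<in>I. F j) $ n = 0"
  using assms(3,4)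
proof (induction I arbitrary: n rule: infinite_finite_induct)
  case (insert j I)
  show ?case
    unfolding prod.insert[OF insert.hyps]
    by (rule fps_mult_supported[where S = S]) (use insert assms(2) in auto)
qed (use assms(1) in \<open>auto simp: fps_one_nth intro!: gr0I\<close>)

section \<open>Logarithmic derivatives of power series\<close>

text \<open>\<open>D = - X F' / F\<close>, free of division, so that it makes sense over the integers.\<close>

definition log_deriv :: "'a::comm_ring_1 fps \<Rightarrow> 'a fps \<Rightarrow> bool" where
  "log_deriv F D \<longleftrightarrow> - (fps_X * fps_deriv F) = F * D"

lemma fps_X_deriv_nth: "(fps_X * fps_deriv F) $ n = of_nat n * (F $ n :: 'a::comm_ring_1)"
  by (cases n) simp_all

lemma log_deriv_mult:
  "log_deriv F D \<Longrightarrow> log_deriv G E \<Longrightarrow> log_deriv (F * G) (D + E)"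
proof -
  assume a: "log_deriv F D" "log_deriv G E"
  have "- (fps_X * fps_deriv (F * G)) = - (fps_X * fps_deriv F) * G + F * - (fps_X * fps_deriv G)"
    by (simp add: algebra_simps)
  also have "\<dots> = (F * G) * (D + E)"
    using a unfolding log_deriv_def by (simp only:) (simp add: algebra_simps)
  finally show ?thesis unfolding log_deriv_def .
qed

lemma log_deriv_cancel:
  fixes F :: "'a::idom fps"
  assumes "log_deriv (F * G) D" "log_deriv G E" "G \<noteq> 0"
  shows "log_deriv F (D - E)"
proof -
  have "- (fps_X * fps_deriv (F * G)) = - (fps_X * fps_deriv F) * G + F * - (fps_X * fps_deriv G)"
    by (simp add: algebra_simps)
  then have "G * - (fps_X * fps_deriv F) = G * (F * (D - E))"
    using assms(1,2) unfolding log_deriv_def by (simp only:) (simp add: algebra_simps)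
  then show ?thesis
    unfolding log_deriv_def mult_left_cancel[OF assms(3)] .
qed

lemma log_deriv_one: "log_deriv 1 0"
  by (simp add: log_deriv_def)

lemma log_deriv_power: "log_deriv F D \<Longrightarrow> log_deriv (F ^ k) (of_nat k * D)"
proof (induction k)
  case (Suc k)
  from log_deriv_mult[OF Suc.prems Suc.IH[OF Suc.prems]] show ?case
    by (simp add: algebra_simps)
qed (simp add: log_deriv_one)

lemma log_deriv_prod:
  "(\<And>j. j \<in> I \<Longrightarrow> log_deriv (F j) (D j)) \<Longrightarrow> log_deriv (\<Prod>j\<in>I. F j) (\<Sum>j\<in>I. D j)"
  by (induction I rule: infinite_finite_induct) (auto intro: log_deriv_one log_deriv_mult)

text \<open>The product of all \<open>(1 - X\<^bsup>j\<^esup>)\<^bsup>f j\<^esup>\<close> has logarithmic derivative \<open>div_sum f\<close>.\<close>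

definition div_sum :: "(nat \<Rightarrow> int) \<Rightarrow> int fps" where
  "div_sum f = Abs_fps (\<lambda>n. \<Sum>j | j \<in> {1..n} \<and> j dvd n. int j * f j)"

lemma div_sum_add: "div_sum f + div_sum g = div_sum (\<lambda>j. f j + g j)"
  by (rule fps_ext) (simp add: div_sum_def sum.distrib ring_distribs)

lemma div_sum_diff: "div_sum f - div_sum g = div_sum (\<lambda>j. f j - g j)"
  by (rule fps_ext) (simp add: div_sum_def sum_subtractf ring_distribs)

lemma div_sum_scale: "of_nat k * div_sum f = div_sum (\<lambda>j. int k * f j)"
  by (induction k) (simp_all add: ring_distribs div_sum_add, simp add: div_sum_def fps_eq_iff)

lemma div_sum_sum: "(\<Sum>i\<in>I. div_sum (f i)) = div_sum (\<lambda>j. \<Sum>i\<in>I. f i j)"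
  by (induction I rule: infinite_finite_induct) (simp_all add: div_sum_add, simp_all add: div_sum_def fps_eq_iff)

lemma div_sum_delta:
  assumes "i > 0"
  shows "div_sum (\<lambda>j. if j = i then 1 else 0) $ n = (if n > 0 \<and> i dvd n then int i else 0)"
proof -
  have "(\<Sum>j | j \<in> {1..n} \<and> j dvd n. int j * (if j = i then 1 else 0))
      = (\<Sum>j | j \<in> {1..n} \<and> j dvd n. if j = i then int i else 0)"
    by (rule sum.cong) auto
  also have "\<dots> = (if n > 0 \<and> i dvd n then int i else 0)"
    using assms by (auto simp: dvd_imp_le)
  finally show ?thesis by (simp add: div_sum_def)
qed

text \<open>For \<open>F = 1 - X^i\<close>, the quotient \<open>- X F' / F\<close> is
  \<open>i X^i / (1 - X^i)\<close>, the geometric series with coefficient \<open>i\<close> at the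
  positive multiples of \<open>i\<close>.\<close>

lemma log_deriv_one_minus_X_power:
  assumes "i > 0"
  shows "log_deriv (1 - fps_X ^ i) (div_sum (\<lambda>j. if j = i then 1 else 0))"
proof -
  let ?L = "div_sum (\<lambda>j. if j = i then 1 else 0)"
  have "((1 - fps_X ^ i) * ?L) $ n = (of_nat i * fps_X ^ i) $ n" for n
  proof -
    have "((1 - fps_X ^ i) * ?L) $ n = ?L $ n - (if n < i then 0 else ?L $ (n - i))"
      by (simp add: left_diff_distrib fps_X_power_mult_nth)
    also have "\<dots> = (if n = i then int i else 0)"
      using assms by (auto simp: div_sum_delta dvd_minus_self dest: dvd_imp_le)
    finally show ?thesis by (simp add: fps_X_power_nth flip: fps_of_nat)
  qed
  then have "(1 - fps_X ^ i) * ?L = of_nat i * fps_X ^ i"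
    by (intro fps_ext)
  moreover have "fps_X * fps_deriv (1 - fps_X ^ i :: int fps) = - (of_nat i * fps_X ^ i)"
    by (rule fps_ext, unfold fps_X_deriv_nth)
      (simp add: fps_X_power_nth fps_one_nth flip: fps_of_nat)
  ultimately show ?thesis by (simp add: log_deriv_def)
qed

text \<open>Inversion over divisors, in place of the Moebius function: in the divisor sum at
  \<open>m\<close>, the proper divisors contribute nothing by induction. The set \<open>M\<close>
  has to contain only those divisors at which \<open>f\<close> is not already known to
  vanish.\<close>

lemma div_sum_eq_0:
  assumes D: "\<And>m. m \<in> M \<Longrightarrow> div_sum f $ m = 0"
    and cl: "\<And>m j. m \<in> M \<Longrightarrow> j \<ge> 1 \<Longrightarrow> j < m \<Longrightarrow> j dvd m \<Longrightarrow> j \<in> M \<or> f j = 0"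
    and "m \<in> M" "m > 0"
  shows "f m = 0"
  using assms(3,4)
proof (induction m rule: less_induct)
  case (less m)
  have "(\<Sum>j | j \<in> {1..m} \<and> j dvd m. int j * f j) = (\<Sum>j\<in>{m}. int j * f j)"
  proof (rule sum.mono_neutral_right)
    show "\<forall>i\<in>{j. j \<in> {1..m} \<and> j dvd m} - {m}. int i * f i = 0"
    proof
      fix j assume "j \<in> {j. j \<in> {1..m} \<and> j dvd m} - {m}"
      then have "1 \<le> j" "j < m" "j dvd m" by auto
      then show "int j * f j = 0"
        using cl[OF less.prems(1), of j] less.IH[of j] by auto
    qed
  qed (use less.prems in auto)
  then show ?case using D[OF less.prems(1)] less.prems(2) by (simp add: div_sum_def)
qed

lemma prod_one_minus_X_power_nth_0:
  assumes "\<And>i. i \<in> I \<Longrightarrow> g i > 0"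
  shows "(\<Prod>i\<in>I. (1 - fps_X ^ g i :: 'a::comm_ring_1 fps) ^ m i) $ 0 = 1"
  using assms
  by (induction I rule: infinite_finite_induct) (simp_all add: fps_power_zeroth power_0_left)

section \<open>Existence and uniqueness of the cyclotomic exponents\<close>

text \<open>The infinite product is never formed. For coefficient \<open>N\<close> the products
  truncated at \<open>N\<close> suffice, because coefficient \<open>k\<close> of
  \<open>div_sum\<close> involves only indices up to \<open>k\<close>.\<close>

lemma cyc_exp_log_deriv:
  assumes "is_cyc_exp S e"
  shows "log_deriv (semigroup_poly S) (div_sum e)"
  unfolding log_deriv_def
proof (rule fps_ext)
  fix N
  let ?P = "semigroup_poly S"
  define I J where "I = {j\<in>{1..N}. e j < 0}" and "J = {j\<in>{1..N}. e j > 0}"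
  define Ne Po :: "int fps" where "Ne = (\<Prod>j\<in>I. (1 - fps_X ^ j) ^ nat (- e j))"
    and "Po = (\<Prod>j\<in>J. (1 - fps_X ^ j) ^ nat (e j))"
  define f where "f = (\<lambda>j. if j \<in> I then - e j else 0)"
  define g where "g = (\<lambda>j. if j \<in> J then e j else 0)"
  have ind: "(\<Sum>i\<in>I. int (nat (- e i)) * (if j = i then 1 else 0)) = f j"
       "(\<Sum>i\<in>J. int (nat (e i)) * (if j = i then 1 else 0)) = g j" for j
    unfolding f_def g_def by (auto simp: I_def J_def if_distrib cong: if_cong)
  have Ne: "log_deriv Ne (div_sum f)"
  proof -
    have "log_deriv Ne (\<Sum>i\<in>I. of_nat (nat (- e i)) * div_sum (\<lambda>j. if j = i then 1 else 0))"
      unfolding Ne_def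
      by (intro log_deriv_prod log_deriv_power log_deriv_one_minus_X_power) (auto simp: I_def)
    then show ?thesis unfolding div_sum_scale div_sum_sum ind .
  qed
  have Po: "log_deriv Po (div_sum g)"
  proof -
    have "log_deriv Po (\<Sum>i\<in>J. of_nat (nat (e i)) * div_sum (\<lambda>j. if j = i then 1 else 0))"
      unfolding Po_def
      by (intro log_deriv_prod log_deriv_power log_deriv_one_minus_X_power) (auto simp: J_def)
    then show ?thesis unfolding div_sum_scale div_sum_sum ind .
  qed
  have eq: "(?P * Ne) $ k = Po $ k" if "k \<le> N" for k
    using assms that unfolding is_cyc_exp_def Ne_def Po_def I_def J_def by blast
  have Ne0: "Ne $ 0 = 1"
    unfolding Ne_def by (rule prod_one_minus_X_power_nth_0) (auto simp: I_def)
  have dd: "div_sum g $ k - div_sum f $ k = div_sum e $ k" if "k \<le> N" for k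
    unfolding div_sum_def fps_nth_Abs_fps sum_subtractf[symmetric]
    by (rule sum.cong) (use that in \<open>auto simp: f_def g_def I_def J_def\<close>)
  \<comment> \<open>\<open>B\<close> is the defect of the claimed identity, with the truncated
    exponents \<open>g - f\<close> in place of \<open>e\<close>. Multiplied by the unit
    \<open>Ne\<close> it is expressed through \<open>?P * Ne - Po\<close>, which vanishes up to
    degree \<open>N\<close>.\<close>
  define B where "B = - (fps_X * fps_deriv ?P) - ?P * (div_sum g - div_sum f)"
  have key: "Ne * B = - (fps_X * fps_deriv (?P * Ne - Po)) - (?P * Ne - Po) * div_sum g"
  proof -
    have a: "fps_X * fps_deriv Ne = - (Ne * div_sum f)" "fps_X * fps_deriv Po = - (Po * div_sum g)"
      using Ne Po unfolding log_deriv_def by (metis minus_minus)+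
    have "- (fps_X * fps_deriv (?P * Ne - Po)) = - (fps_X * fps_deriv ?P) * Ne
        - ?P * (fps_X * fps_deriv Ne) + fps_X * fps_deriv Po"
      by (simp add: algebra_simps)
    then show ?thesis unfolding a B_def by (simp add: algebra_simps)
  qed
  have r0: "(?P * Ne - Po) $ k = 0" if "k \<in> {..N}" for k
    using eq that by simp
  have "B $ N = 0"
  proof (rule fps_cancel_vanish[where S = UNIV and T = "{..N}" and F = Ne])
    fix n assume n: "n \<in> {..N}"
    have "(fps_X * fps_deriv (?P * Ne - Po)) $ n = 0"
      unfolding fps_X_deriv_nth r0[OF n] by simp
    moreover have "(div_sum g * (?P * Ne - Po)) $ n = 0"
      by (rule fps_mult_vanish[where S = UNIV and T = "{..N}"]) (use n r0 in auto)
    ultimately show "(Ne * B) $ n = 0"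
      unfolding key by (simp add: mult.commute)
  qed (use Ne0 in auto)
  moreover have "(?P * (div_sum g - div_sum f)) $ N = (?P * div_sum e) $ N"
    unfolding fps_mult_nth by (rule sum.cong) (simp_all add: dd)
  ultimately show "(- (fps_X * fps_deriv ?P)) $ N = (?P * div_sum e) $ N"
    by (simp add: B_def)
qed

text \<open>In the integral domain of integer power series, a nonzero series determines its
  logarithmic derivative, and inversion over divisors recovers the exponents from it.\<close>

lemma is_cyc_exp_unique:
  assumes "semigroup_poly S \<noteq> 0" "is_cyc_exp S e" "is_cyc_exp S f"
  shows "e = f"
proof
  fix n
  have "semigroup_poly S * div_sum e = semigroup_poly S * div_sum f"
    using cyc_exp_log_deriv[OF assms(2)] cyc_exp_log_deriv[OF assms(3)]
    by (simp add: log_deriv_def)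
  then have "div_sum e = div_sum f" using assms(1) by simp
  then have "div_sum (\<lambda>j. e j - f j) = 0" by (simp flip: div_sum_diff)
  then have "e n - f n = 0" if "n > 0"
    by (intro div_sum_eq_0[where M = UNIV and m = n and f = "\<lambda>j. e j - f j"]) (use that in auto)
  moreover have "e 0 = 0" "f 0 = 0" using assms by (auto simp: is_cyc_exp_def)
  ultimately show "e n = f n" by (cases n) auto
qed

lemma one_minus_X_power_power_nth:
  assumes "n > 0" "k \<le> n"
  shows "((1 - fps_X ^ n :: int fps) ^ m) $ k = (if k = 0 then 1 else if k = n then - int m else 0)"
  using assms
proof (induction m arbitrary: k)
  case (Suc m)
  have "((1 - fps_X ^ n :: int fps) ^ Suc m) $ k
     = ((1 - fps_X ^ n) ^ m) $ k - (if k < n then 0 else ((1 - fps_X ^ n) ^ m) $ (k - n))"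
    by (simp add: left_diff_distrib fps_X_power_mult_nth)
  then show ?case using Suc by auto
qed simp

text \<open>Modulo \<open>X^(n+1)\<close> the power is \<open>1 - m X^n\<close>, so up to degree
  \<open>n\<close> the new factor affects only the coefficient at \<open>n\<close>.\<close>

lemma mult_one_minus_X_power_power_nth:
  fixes F :: "int fps"
  assumes "n > 0" "k \<le> n" "F $ 0 = 1"
  shows "(F * (1 - fps_X ^ n) ^ m) $ k = F $ k - (if k = n then int m else 0)"
proof -
  have "(F * (1 - fps_X ^ n) ^ m) $ k = (\<Sum>i=0..k. F $ i * ((1 - fps_X ^ n) ^ m) $ (k - i))"
    by (simp add: fps_mult_nth)
  also have "\<dots> = (\<Sum>i=0..k. (if i = k then F $ i else 0) - (if i = 0 then if k = n then int m else 0 else 0))"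
  proof (rule sum.cong[OF refl])
    fix i assume i: "i \<in> {0..k}"
    show "F $ i * ((1 - fps_X ^ n) ^ m) $ (k - i)
        = (if i = k then F $ i else 0) - (if i = 0 then if k = n then int m else 0 else 0)"
      using i assms by (subst one_minus_X_power_power_nth) auto
  qed
  also have "\<dots> = F $ k - (if k = n then int m else 0)"
    by (simp add: sum_subtractf)
  finally show ?thesis .
qed

text \<open>The exponents are chosen one after another: the factor with index \<open>N + 1\<close>
  leaves the coefficients up to \<open>N\<close> alone and can correct the next one.\<close>

lemma is_cyc_exp_exists:
  assumes P0: "semigroup_poly S $ 0 = 1"
  shows "\<exists>e. is_cyc_exp S e"
proof -
  define Ne :: "(nat \<Rightarrow> int) \<Rightarrow> nat \<Rightarrow> int fps" where
    "Ne = (\<lambda>e N. \<Prod>j\<in>{j\<in>{1..N}. e j < 0}. (1 - fps_X ^ j) ^ nat (- e j))"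
  define Po :: "(nat \<Rightarrow> int) \<Rightarrow> nat \<Rightarrow> int fps" where
    "Po = (\<lambda>e N. \<Prod>j\<in>{j\<in>{1..N}. e j > 0}. (1 - fps_X ^ j) ^ nat (e j))"
  define ok where "ok = (\<lambda>N e. e 0 = 0 \<and> (\<forall>k\<le>N. (semigroup_poly S * Ne e N) $ k = Po e N $ k))"
  have cong: "Ne e N = Ne f N" "Po e N = Po f N" if "\<And>j. j \<in> {1..N} \<Longrightarrow> e j = f j" for e f N
    unfolding Ne_def Po_def using that by (auto intro!: prod.cong)
  have nth0: "Ne e N $ 0 = 1" "Po e N $ 0 = 1" for e N
    unfolding Ne_def Po_def by (rule prod_one_minus_X_power_nth_0; auto)+
  have Suc_Ne: "Ne e (Suc N) = Ne e N * (1 - fps_X ^ Suc N) ^ nat (- e (Suc N))" for e N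
  proof -
    have "{j\<in>{1..Suc N}. e j < 0} = (if e (Suc N) < 0 then insert (Suc N) {j\<in>{1..N}. e j < 0}
        else {j\<in>{1..N}. e j < 0})"
      by (auto simp: le_Suc_eq)
    then show ?thesis unfolding Ne_def by (simp add: mult.commute)
  qed
  have Suc_Po: "Po e (Suc N) = Po e N * (1 - fps_X ^ Suc N) ^ nat (e (Suc N))" for e N
  proof -
    have "{j\<in>{1..Suc N}. e j > 0} = (if e (Suc N) > 0 then insert (Suc N) {j\<in>{1..N}. e j > 0}
        else {j\<in>{1..N}. e j > 0})"
      by (auto simp: le_Suc_eq)
    then show ?thesis unfolding Po_def by (simp add: mult.commute)
  qed
  have "\<exists>E. \<forall>N. ok N (E N) \<and> (\<exists>c. E (Suc N) = (E N)(Suc N := c))"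
  proof (rule dependent_nat_choice)
    show "\<exists>e. ok 0 e"
      by (rule exI[of _ "\<lambda>_. 0"]) (simp add: ok_def Ne_def Po_def P0)
  next
    fix e N assume e: "ok N e"
    \<comment> \<open>The mismatch at degree \<open>N + 1\<close>. A positive \<open>c\<close>
      lowers the coefficient on the right by \<open>c\<close>, a negative one lowers the coefficient
      on the left by \<open>- c\<close>; either way the two sides become equal.\<close>
    define c where "c = (Po e N - semigroup_poly S * Ne e N) $ Suc N"
    define e' where "e' = e(Suc N := c)"
    have c1: "Ne e' N = Ne e N" "Po e' N = Po e N"
      by (rule cong; simp add: e'_def)+
    have "(semigroup_poly S * Ne e' (Suc N)) $ k = Po e' (Suc N) $ k" if "k \<le> Suc N" for k
    proof -
      have "(semigroup_poly S * Ne e' (Suc N)) $ k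
          = (semigroup_poly S * Ne e N) $ k - (if k = Suc N then int (nat (- c)) else 0)"
        unfolding Suc_Ne mult.assoc[symmetric] c1
        by (subst mult_one_minus_X_power_power_nth) (use that in \<open>auto simp: P0 nth0 e'_def\<close>)
      moreover have "Po e' (Suc N) $ k = Po e N $ k - (if k = Suc N then int (nat c) else 0)"
        unfolding Suc_Po c1
        by (subst mult_one_minus_X_power_power_nth) (use that in \<open>auto simp: P0 nth0 e'_def\<close>)
      ultimately show ?thesis
        using that e by (cases "k = Suc N") (auto simp: c_def ok_def)
    qed
    then have "ok (Suc N) e'" using e by (simp add: ok_def e'_def)
    then show "\<exists>e'. ok (Suc N) e' \<and> (\<exists>c. e' = e(Suc N := c))"
      unfolding e'_def by blast
  qed
  then obtain E where E: "\<And>N. ok N (E N)" "\<And>N. \<exists>c. E (Suc N) = (E N)(Suc N := c)" by blast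
  \<comment> \<open>The diagonal: entry \<open>j\<close> no longer changes from stage
    \<open>j\<close> on.\<close>
  define e where "e = (\<lambda>j. E j j)"
  have stable: "E N j = e j" if "j \<le> N" for N j
    using that
  proof (induction N)
    case (Suc N)
    then show ?case using E(2)[of N] by (cases "j = Suc N") (auto simp: e_def)
  qed (simp add: e_def)
  have "ok N e" for N
    using E(1)[of N] cong[of N e "E N"] stable[of _ N] by (simp add: ok_def)
  then show ?thesis
    unfolding is_cyc_exp_def ok_def Ne_def Po_def by blast
qed

lemma fun_le_diff_add: "y \<le> x \<Longrightarrow> x - y + y = x" for x y :: "'a \<Rightarrow> nat"
  by (auto simp: le_fun_def fun_eq_iff)

section \<open>Factorizations in a numerical semigroup\<close>

locale num_semigroup =
  fixes S :: "nat set"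
  assumes ns: "numerical_semigroup S"
begin

abbreviation A :: "nat set" where "A \<equiv> min_gens S"

definition vecs :: "(nat \<Rightarrow> nat) set" where
  "vecs = {x. \<forall>n. n \<notin> A \<longrightarrow> x n = 0}"

definition phi :: "(nat \<Rightarrow> nat) \<Rightarrow> nat" where
  "phi x = (\<Sum>n\<in>A. x n * n)"

definition unit_vec :: "nat \<Rightarrow> nat \<Rightarrow> nat" where
  "unit_vec n = (\<lambda>k. if k = n then 1 else 0)"

definition below :: "nat \<Rightarrow> nat \<Rightarrow> bool" where
  "below a b \<longleftrightarrow> a \<le> b \<and> b - a \<in> S"

definition disj_supp :: "(nat \<Rightarrow> nat) \<Rightarrow> (nat \<Rightarrow> nat) \<Rightarrow> bool" where
  "disj_supp x y \<longleftrightarrow> (\<forall>n. x n = 0 \<or> y n = 0)"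

lemma zero_S: "0 \<in> S" and add_S: "a \<in> S \<Longrightarrow> b \<in> S \<Longrightarrow> a + b \<in> S"
  and fin_S: "finite (UNIV - S)"
  using ns by (auto simp: numerical_semigroup_def)

lemma mult_S: "n \<in> S \<Longrightarrow> k * n \<in> S"
  by (induction k) (auto intro: zero_S add_S)

lemma le_S_iff_below: "le_S S (int a) (int b) \<longleftrightarrow> below a b"
  by (auto simp: le_S_def below_def nat_diff_distrib simp flip: of_nat_diff)

lemma below_refl: "below a a"
  by (simp add: below_def zero_S)

lemma below_trans: "below a b \<Longrightarrow> below b c \<Longrightarrow> below a c"
  using add_S[of "b - a" "c - b"] by (simp add: below_def)

lemma below_le: "below a b \<Longrightarrow> a \<le> b"
  by (simp add: below_def)

lemma below_diff: "below a b \<Longrightarrow> below b c \<Longrightarrow> below (b - a) c" if "a \<in> S"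
proof -
  assume "below a b" "below b c"
  then have "c - (b - a) = (c - b) + a" "b - a \<le> c" "c - b \<in> S" by (auto simp: below_def)
  then show ?thesis using add_S[of "c - b" a] that by (simp add: below_def)
qed

lemma mem_A: "n \<in> A \<Longrightarrow> n \<in> S" "n \<in> A \<Longrightarrow> n > 0"
  by (auto simp: min_gens_def)

lemma finite_A: "finite A"
proof -
  obtain c where c: "\<And>n. n \<notin> S \<Longrightarrow> n < c"
    using fin_S finite_nat_set_iff_bounded[of "UNIV - S"] by auto
  have "n < 2 * c + 2" if "n \<in> A" for n
  proof (rule ccontr)
    assume "\<not> n < 2 * c + 2"
    \<comment> \<open>All numbers from \<open>c\<close> on lie in \<open>S\<close>. Splitting off
      \<open>c + 1\<close> rather than \<open>c\<close> keeps the first summand nonzero even if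
      \<open>c = 0\<close>.\<close>
    then have "c + 1 \<in> S" "n - (c + 1) \<in> S" "n = (c + 1) + (n - (c + 1))" "n - (c + 1) \<noteq> 0"
      using c[of "c + 1"] c[of "n - (c + 1)"] by force+
    then have "\<exists>a\<in>S. \<exists>b\<in>S. a \<noteq> 0 \<and> b \<noteq> 0 \<and> n = a + b"
      by (metis add_is_0 one_neq_zero)
    then show False using that unfolding min_gens_def by blast
  qed
  then show ?thesis
    by (intro finite_subset[of A "{..<2 * c + 2}"]) auto
qed

lemma factorizations_iff: "x \<in> factorizations S t \<longleftrightarrow> x \<in> vecs \<and> phi x = t"
  by (auto simp: factorizations_def vecs_def phi_def)

lemma phi_add: "phi (x + y) = phi x + phi y"
  by (simp add: phi_def sum.distrib ring_distribs)

lemma phi_zero: "phi 0 = 0"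
  by (simp add: phi_def)

lemma vecs_add: "x \<in> vecs \<Longrightarrow> y \<in> vecs \<Longrightarrow> x + y \<in> vecs"
  by (auto simp: vecs_def)

lemma vecs_diff: "x \<in> vecs \<Longrightarrow> x - y \<in> vecs"
  by (auto simp: vecs_def)

lemma phi_diff: "y \<le> x \<Longrightarrow> phi (x - y) = phi x - phi y" and phi_mono: "y \<le> x \<Longrightarrow> phi y \<le> phi x"
  using phi_add[of "x - y" y] by (simp_all add: fun_le_diff_add)

lemma phi_unit_vec: "n \<in> A \<Longrightarrow> phi (unit_vec n) = n"
  by (simp add: phi_def unit_vec_def finite_A if_distrib[of "\<lambda>x. x * _"] cong: if_cong)

lemma unit_vec_vecs: "n \<in> A \<Longrightarrow> unit_vec n \<in> vecs"
  by (auto simp: vecs_def unit_vec_def)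

lemma unit_vec_le: "unit_vec n \<le> x \<longleftrightarrow> x n > 0"
  by (auto simp: unit_vec_def le_fun_def)

lemma phi_eq_0: "x \<in> vecs \<Longrightarrow> phi x = 0 \<longleftrightarrow> x = 0"
  using finite_A mem_A(2) by (auto simp: phi_def vecs_def fun_eq_iff)

lemma phi_in_S: "phi x \<in> S"
proof -
  have "finite B \<Longrightarrow> B \<subseteq> A \<Longrightarrow> (\<Sum>n\<in>B. x n * n) \<in> S" for B
    by (induction B rule: finite_induct) (auto intro: zero_S add_S mult_S mem_A)
  then show ?thesis using finite_A by (simp add: phi_def)
qed

lemma ex_factorization: "s \<in> S \<Longrightarrow> \<exists>x\<in>vecs. phi x = s"
proof (induction s rule: less_induct)
  case (less s)
  consider "s = 0" | "s \<in> A" | a b where "a \<in> S" "b \<in> S" "a \<noteq> 0" "b \<noteq> 0" "s = a + b"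
    using less.prems by (auto simp: min_gens_def)
  then show ?case
  proof cases
    case 1
    then show ?thesis by (intro bexI[of _ 0]) (auto simp: phi_def vecs_def)
  next
    case 2
    then show ?thesis using phi_unit_vec unit_vec_vecs by blast
  next
    case 3
    then obtain x y where "x \<in> vecs" "phi x = a" "y \<in> vecs" "phi y = b"
      using less.IH[of a] less.IH[of b] by auto
    then show ?thesis using 3 phi_add vecs_add by blast
  qed
qed

lemma below_phi: "y \<le> x \<Longrightarrow> below (phi y) (phi x)"
  using phi_in_S[of "x - y"] by (simp add: below_def phi_mono phi_diff)

lemma below_ex_add:
  assumes "below (phi x) t" "x \<in> vecs"
  obtains u where "u \<in> vecs" "phi (x + u) = t" "x + u \<in> vecs" "t \<noteq> phi x \<Longrightarrow> u \<noteq> 0"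
proof -
  obtain u where "u \<in> vecs" "phi u = t - phi x"
    using ex_factorization assms(1) by (auto simp: below_def)
  then show ?thesis
    using that[of u] assms by (force simp: below_def phi_add vecs_add phi_zero)
qed

lemma finite_factorizations: "finite (factorizations S t)"
proof (rule finite_subset)
  show "factorizations S t \<subseteq> {x. \<forall>n. (n \<in> A \<longrightarrow> x n \<in> {..t}) \<and> (n \<notin> A \<longrightarrow> x n = 0)}"
  proof
    fix x assume x: "x \<in> factorizations S t"
    have "x n \<le> t" if "n \<in> A" for n
    proof -
      have "x n * n \<le> phi x"
        unfolding phi_def using finite_A that by (intro member_le_sum) auto
      moreover have "x n \<le> x n * n"
        using mem_A(2)[OF that] by simp
      ultimately show ?thesis using x by (metis factorizations_iff le_trans)
    qed
    then show "x \<in> {x. \<forall>n. (n \<in> A \<longrightarrow> x n \<in> {..t}) \<and> (n \<notin> A \<longrightarrow> x n = 0)}"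
      using x by (auto simp: factorizations_iff vecs_def)
  qed
  show "finite {x. \<forall>n. (n \<in> A \<longrightarrow> x n \<in> {..t}) \<and> (n \<notin> A \<longrightarrow> x n = (0::nat))}"
    using finite_A by (intro finite_set_of_finite_funs) auto
qed

lemma disj_supp_sym: "disj_supp x y \<Longrightarrow> disj_supp y x"
  unfolding disj_supp_def by metis

text \<open>Adding \<open>y\<close> changes no coordinate at which \<open>x\<close> is
  positive.\<close>

lemma disj_supp_le_add: "disj_supp x y \<Longrightarrow> x \<le> u + y \<longleftrightarrow> x \<le> u"
  unfolding disj_supp_def le_fun_def by (simp, metis add.right_neutral le0 trans_le_add1)

lemma dot_eq_0: "x \<in> vecs \<Longrightarrow> (\<Sum>n\<in>A. x n * y n) = 0 \<longleftrightarrow> disj_supp x y"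
  using finite_A by (auto simp: disj_supp_def vecs_def)

section \<open>Counting vectors that avoid a set\<close>

text \<open>In algebraic terms, the Hilbert series of the polynomial ring on the generators modulo
  the monomial ideal generated by \<open>Y\<close>, graded by \<open>phi\<close>.\<close>

definition avoiders :: "(nat \<Rightarrow> nat) set \<Rightarrow> int fps" where
  "avoiders Y = Abs_fps (\<lambda>t. int (card {x \<in> factorizations S t. \<forall>y\<in>Y. \<not> y \<le> x}))"

text \<open>If the support of \<open>y\<close> is disjoint from those of the vectors in \<open>Y\<close>, then \<open>x \<mapsto> x + y\<close> maps the vectors
  avoiding \<open>Y\<close> onto those that avoid \<open>Y\<close> and lie above \<open>y\<close>.\<close>

lemma avoiders_eq:
  assumes "finite Y" "Y \<subseteq> vecs" "pairwise disj_supp Y"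
  shows "avoiders Y = avoiders {} * (\<Prod>y\<in>Y. 1 - fps_X ^ phi y)"
  using assms
proof (induction Y rule: finite_induct)
  case (insert y Y)
  let ?Z = "\<lambda>t. {x \<in> factorizations S t. \<forall>z\<in>Y. \<not> z \<le> x}"
  have dj: "disj_supp z y" if "z \<in> Y" for z
    using insert.prems insert.hyps that by (auto simp: pairwise_def)
  have y: "y \<in> vecs" using insert.prems by auto
  have "avoiders (insert y Y) $ t = (avoiders Y * (1 - fps_X ^ phi y)) $ t" for t
  proof -
    have fin: "finite (?Z t)" for t
      using finite_factorizations[of t] by auto
    have "{x \<in> factorizations S t. \<forall>z\<in>insert y Y. \<not> z \<le> x} = ?Z t - {x \<in> ?Z t. y \<le> x}"
      by auto
    moreover have "int (card (?Z t - {x \<in> ?Z t. y \<le> x})) = int (card (?Z t)) - int (card {x \<in> ?Z t. y \<le> x})"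
      using finite_factorizations[of t] by (subst card_Diff_subset) (auto intro!: of_nat_diff card_mono)
    ultimately have 1: "int (card {x \<in> factorizations S t. \<forall>z\<in>insert y Y. \<not> z \<le> x})
        = int (card (?Z t)) - int (card {x \<in> ?Z t. y \<le> x})"
      by (simp only:)
    have "card {x \<in> ?Z t. y \<le> x} = (if t < phi y then 0 else card (?Z (t - phi y)))"
    proof (cases "t < phi y")
      case True
      then have "{x \<in> ?Z t. y \<le> x} = {}"
        using phi_mono by (auto simp: factorizations_iff) (use leD in blast)
      then show ?thesis using True by (simp only:) simp
    next
      case False
      have "bij_betw (\<lambda>x. x + y) (?Z (t - phi y)) {x \<in> ?Z t. y \<le> x}"
      proof (rule bij_betw_byWitness[where f' = "\<lambda>x. x - y"])
        show "\<forall>a\<in>?Z (t - phi y). a + y - y = a"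
          by (auto simp: fun_eq_iff)
        show "\<forall>a\<in>{x \<in> ?Z t. y \<le> x}. a - y + y = a"
          by (auto simp: fun_le_diff_add)
        show "(\<lambda>x. x + y) ` ?Z (t - phi y) \<subseteq> {x \<in> ?Z t. y \<le> x}"
          using False y dj
          by (auto simp: factorizations_iff phi_add vecs_add disj_supp_le_add) (auto simp: le_fun_def)
        show "(\<lambda>x. x - y) ` {x \<in> ?Z t. y \<le> x} \<subseteq> ?Z (t - phi y)"
        proof
          fix v assume "v \<in> (\<lambda>x. x - y) ` {x \<in> ?Z t. y \<le> x}"
          then obtain x where x: "x \<in> ?Z t" "y \<le> x" "v = x - y" by auto
          have "\<not> z \<le> v" if "z \<in> Y" for z
            using x that disj_supp_le_add[OF dj[OF that], of v] by (auto simp: fun_le_diff_add)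
          then show "v \<in> ?Z (t - phi y)"
            using x by (auto simp: factorizations_iff phi_diff vecs_diff)
        qed
      qed
      then show ?thesis using False by (simp add: bij_betw_same_card)
    qed
    with 1 show ?thesis
      by (simp add: avoiders_def right_diff_distrib fps_X_power_mult_right_nth)
  qed
  then have "avoiders (insert y Y) = avoiders Y * (1 - fps_X ^ phi y)"
    by (rule fps_ext)
  also have "avoiders Y = avoiders {} * (\<Prod>y\<in>Y. 1 - fps_X ^ phi y)"
    by (rule insert.IH) (use insert.prems in \<open>auto simp: pairwise_insert\<close>)
  finally show ?case
    using insert.hyps by (simp add: mult.assoc mult.commute)
qed simp

text \<open>Taking all unit vectors for \<open>Y\<close> leaves only the zero vector, so the count
  becomes the series 1.\<close>

lemma avoiders_empty: "avoiders {} * (\<Prod>n\<in>A. 1 - fps_X ^ n) = 1"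
proof -
  have inj: "inj_on unit_vec A"
    by (auto simp: inj_on_def unit_vec_def fun_eq_iff split: if_splits)
  have "avoiders (unit_vec ` A) = avoiders {} * (\<Prod>y\<in>unit_vec ` A. 1 - fps_X ^ phi y)"
  proof (rule avoiders_eq)
    show "pairwise disj_supp (unit_vec ` A)"
      by (auto simp: pairwise_def disj_supp_def unit_vec_def)
  qed (use finite_A unit_vec_vecs in auto)
  also have "(\<Prod>y\<in>unit_vec ` A. 1 - fps_X ^ phi y) = (\<Prod>n\<in>A. 1 - fps_X ^ n)"
    unfolding prod.reindex[OF inj] by (rule prod.cong) (auto simp: phi_unit_vec)
  finally have "avoiders {} * (\<Prod>n\<in>A. 1 - fps_X ^ n) = avoiders (unit_vec ` A)" by simp
  also have "\<dots> = 1"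
  proof (rule fps_ext)
    fix t
    have "{x \<in> factorizations S t. \<forall>y\<in>unit_vec ` A. \<not> y \<le> x} = (if t = 0 then {0} else {})"
      by (auto simp: unit_vec_le factorizations_iff vecs_def phi_def fun_eq_iff) blast
    then show "avoiders (unit_vec ` A) $ t = 1 $ t"
      by (simp add: avoiders_def fps_one_nth)
  qed
  finally show ?thesis .
qed

section \<open>Isolated factorizations and R-classes\<close>

text \<open>The isolated vertices of disconnected graphs of factorizations.\<close>

definition prim :: "(nat \<Rightarrow> nat) \<Rightarrow> bool" where
  "prim x \<longleftrightarrow> x \<in> vecs \<and> (\<exists>y\<in>vecs. phi y = phi x \<and> y \<noteq> x)
     \<and> (\<forall>y\<in>vecs. phi y = phi x \<longrightarrow> y \<noteq> x \<longrightarrow> disj_supp x y)"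

text \<open>Descent: if \<open>x\<close> is not isolated, it shares a generator with another
  factorization. Subtracting that generator from both leaves two distinct factorizations of a
  smaller element.\<close>

lemma ex_prim_le:
  assumes "x \<in> vecs" "y \<in> vecs" "x \<noteq> y" "phi x = phi y"
  shows "\<exists>p. prim p \<and> p \<le> x"
  using assms
proof (induction "phi x" arbitrary: x y rule: less_induct)
  case less
  show ?case
  proof (cases "prim x")
    case False
    then obtain y where y: "y \<in> vecs" "phi y = phi x" "y \<noteq> x" "\<not> disj_supp x y"
      using less.prems unfolding prim_def by metis
    then obtain n where n: "x n > 0" "y n > 0" by (auto simp: disj_supp_def)
    then have nA: "n \<in> A" using less.prems(1) by (auto simp: vecs_def)
    have u: "unit_vec n \<le> x" "unit_vec n \<le> y" using n by (auto simp: unit_vec_le)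
    have "x - unit_vec n \<noteq> y - unit_vec n"
      using y(3) u fun_le_diff_add by metis
    moreover have "phi (x - unit_vec n) < phi x"
      using u phi_mono[OF u(1)] mem_A(2)[OF nA] by (simp add: phi_diff phi_unit_vec nA)
    ultimately obtain p where "prim p" "p \<le> x - unit_vec n"
      using less.hyps[of "x - unit_vec n" "y - unit_vec n"] less.prems y u
      by (auto simp: vecs_diff phi_diff)
    moreover have "x - unit_vec n \<le> x" by (simp add: le_fun_def)
    ultimately show ?thesis using order_trans by blast
  qed auto
qed

lemma prim_vecs: "prim p \<Longrightarrow> p \<in> vecs"
  by (simp add: prim_def)

lemma prim_alternative: "prim p \<Longrightarrow> \<exists>q\<in>vecs. phi q = phi p \<and> q \<noteq> p"
  by (simp add: prim_def)

lemma prim_disj: "prim p \<Longrightarrow> q \<in> vecs \<Longrightarrow> phi q = phi p \<Longrightarrow> q \<noteq> p \<Longrightarrow> disj_supp p q"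
  by (simp add: prim_def)

lemma prim_nonzero: "prim p \<Longrightarrow> p \<noteq> 0"
  using prim_alternative[of p] phi_eq_0 by (auto simp: phi_zero)

lemma prim_phi_pos: "prim p \<Longrightarrow> phi p > 0"
  using prim_nonzero prim_vecs phi_eq_0 by blast

text \<open>With \<open>p'\<close> another factorization of the degree of \<open>p\<close>, the
  vectors \<open>p + u\<close> and \<open>p' + u\<close> have the same degree and share the support
  of \<open>u\<close>.\<close>

lemma prim_add_not_prim:
  assumes "prim p" "u \<in> vecs" "u \<noteq> 0"
  shows "\<not> prim (p + u)"
proof
  assume q: "prim (p + u)"
  obtain p' where p': "p' \<in> vecs" "phi p' = phi p" "p' \<noteq> p"
    using prim_alternative assms(1) by blast
  have "disj_supp (p + u) (p' + u)"
    by (rule prim_disj[OF q]) (use p' assms in \<open>auto simp: vecs_add phi_add\<close>)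
  then have "u = 0" by (auto simp: disj_supp_def fun_eq_iff)
  then show False using assms by simp
qed

text \<open>For different degrees, \<open>p\<close> extends to a factorization \<open>p + u\<close>
  of the degree of \<open>q\<close>. It is not isolated, hence differs from \<open>q\<close>, and so
  \<open>q\<close> is disjoint from it.\<close>

lemma prim_disj_below:
  assumes "prim p" "prim q" "p \<noteq> q" "below (phi p) (phi q)"
  shows "disj_supp p q"
proof (cases "phi p = phi q")
  case True
  then show ?thesis using assms prim_disj prim_vecs by metis
next
  case False
  obtain u where u: "u \<in> vecs" "phi (p + u) = phi q" "p + u \<in> vecs" "u \<noteq> 0"
    using below_ex_add[OF assms(4) prim_vecs[OF assms(1)]] False by metis
  have "p + u \<noteq> q" using prim_add_not_prim assms u by blast
  then have "disj_supp q (p + u)" using prim_disj assms(2) u by blast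
  then show ?thesis unfolding disj_supp_def by (metis add_is_0 plus_fun_apply)
qed

lemma fact_adj_iff:
  "(x, y) \<in> fact_adj S t \<longleftrightarrow> x \<in> vecs \<and> y \<in> vecs \<and> phi x = t \<and> phi y = t \<and> x \<noteq> y \<and> \<not> disj_supp x y"
  using dot_eq_0[of x y] by (auto simp: fact_adj_def factorizations_iff)

lemma sym_fact_adj: "sym ((fact_adj S t)\<^sup>*)"
  by (intro sym_rtrancl symI) (auto simp: fact_adj_iff dest: disj_supp_sym)

lemma fact_adj_class_subset:
  "x \<in> factorizations S t \<Longrightarrow> (fact_adj S t)\<^sup>* `` {x} \<subseteq> factorizations S t"
proof
  fix y assume x: "x \<in> factorizations S t" and "y \<in> (fact_adj S t)\<^sup>* `` {x}"
  then have "(x, y) \<in> (fact_adj S t)\<^sup>*" by simp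
  then show "y \<in> factorizations S t"
    by (induction rule: rtrancl_induct) (use x in \<open>auto simp: fact_adj_iff factorizations_iff\<close>)
qed

lemma prim_class: "prim p \<Longrightarrow> (fact_adj S (phi p))\<^sup>* `` {p} = {p}"
proof (intro equalityI subsetI)
  fix y assume p: "prim p" and "y \<in> (fact_adj S (phi p))\<^sup>* `` {p}"
  then have "(p, y) \<in> (fact_adj S (phi p))\<^sup>*" by simp
  then show "y \<in> {p}"
  proof (rule converse_rtranclE)
    fix z assume "(p, z) \<in> fact_adj S (phi p)"
    then show "y \<in> {p}"
      using p prim_disj by (auto simp: fact_adj_iff)
  qed simp
qed auto

lemma finite_R_classes: "finite (R_classes S t)"
  unfolding R_classes_def by (simp add: quotient_def finite_factorizations)

lemma R_classes_I: "x \<in> vecs \<Longrightarrow> phi x = t \<Longrightarrow> (fact_adj S t)\<^sup>* `` {x} \<in> R_classes S t"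
  unfolding R_classes_def by (rule quotientI) (simp add: factorizations_iff)

lemma prim_Betti:
  assumes p: "prim p"
  shows "phi p \<in> Betti S"
proof -
  obtain q where q: "q \<in> vecs" "phi q = phi p" "q \<noteq> p" using prim_alternative p by blast
  let ?C = "(fact_adj S (phi p))\<^sup>* `` {q}"
  have "{p} \<in> R_classes S (phi p)"
    using R_classes_I[of p "phi p"] prim_class[OF p] prim_vecs[OF p] by simp
  moreover have "?C \<in> R_classes S (phi p)" using q by (intro R_classes_I)
  moreover have "q \<in> ?C" by simp
  then have "{p} \<noteq> ?C" using q by blast
  ultimately have "card {{p}, ?C} \<le> card (R_classes S (phi p))"
    by (intro card_mono finite_R_classes) simp
  moreover have "card {{p}, ?C} = 2"
    using \<open>{p} \<noteq> ?C\<close> by (rule card_2_iff[THEN iffD2, OF exI, OF exI, OF conjI[OF refl]])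
  ultimately show ?thesis by (simp add: Betti_def phi_in_S)
qed

lemma Betti_nonunique:
  assumes "b \<in> Betti S"
  obtains x y where "x \<in> vecs" "y \<in> vecs" "x \<noteq> y" "phi x = b" "phi y = b"
proof -
  let ?R = "(fact_adj S b)\<^sup>*"
  have "2 \<le> card (R_classes S b)" using assms by (simp add: Betti_def)
  also have "\<dots> \<le> card (factorizations S b)"
    unfolding R_classes_def quotient_def UNION_singleton_eq_range
    by (intro card_image_le finite_factorizations)
  finally obtain x y where "x \<in> factorizations S b" "y \<in> factorizations S b" "x \<noteq> y"
    using card_le_Suc0_iff_eq[OF finite_factorizations[of b]] by force
  then show ?thesis using that by (auto simp: factorizations_iff)
qed

text \<open>The isolated factorizations of \<open>t\<close> other than \<open>z\<close> are
  singleton classes; all remaining ones form the one further class \<open>C\<close>. If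
  \<open>t\<close> is the degree of \<open>z\<close>, this class is just \<open>{z}\<close>, which
  is why \<open>z\<close> is excluded from the count.\<close>

lemma nc_eq_card_prim:
  assumes z: "\<And>p. prim p \<Longrightarrow> below (phi p) t \<Longrightarrow> prim z \<and> below (phi z) (phi p)"
    and t: "t \<in> S"
  shows "nc S t = card {p. prim p \<and> phi p = t \<and> p \<noteq> z} + 1"
proof -
  let ?R = "(fact_adj S t)\<^sup>*"
  define P where "P = {p. prim p \<and> phi p = t \<and> p \<noteq> z}"
  define C where "C = factorizations S t - P"
  have C_iff: "x \<in> C \<longleftrightarrow> x \<in> vecs \<and> phi x = t \<and> (prim x \<longrightarrow> x = z)" for x
    by (auto simp: C_def P_def factorizations_iff)
  have P_class: "?R `` {p} = {p}" if "p \<in> P" for p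
    using prim_class[of p] that by (simp add: P_def)
  have class_sub: "?R `` {c} \<subseteq> C" if "c \<in> C" for c
  proof
    fix y assume y: "y \<in> ?R `` {c}"
    have "y \<notin> P"
    proof
      assume "y \<in> P"
      moreover have "c \<in> ?R `` {y}"
        using y sym_fact_adj[of t] by (auto dest: symD)
      ultimately show False using P_class[of y] that by (auto simp: C_def)
    qed
    then show "y \<in> C"
      using y fact_adj_class_subset[of c t] that by (auto simp: C_def)
  qed
  \<comment> \<open>A hub of \<open>C\<close>. If no isolated vector has degree below
    \<open>t\<close>, then \<open>t\<close> has a single factorization; otherwise any factorization
    \<open>z + u\<close> serves.\<close>
  have "\<exists>c\<in>C. \<forall>x\<in>C. (x, c) \<in> ?R"
  proof (cases "\<exists>p. prim p \<and> below (phi p) t")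
    case False
    obtain c where c: "c \<in> vecs" "phi c = t" using ex_factorization t by blast
    have "\<not> prim x" if "phi x = t" for x
      using False that below_refl by blast
    then have "c \<in> C" using c by (simp add: C_iff)
    moreover have "x = c" if x: "x \<in> C" for x
    proof (rule ccontr)
      assume "x \<noteq> c"
      then obtain p where "prim p" "p \<le> x"
        using ex_prim_le[of x c] x c by (auto simp: C_iff)
      then show False using False below_phi[of p x] that by (auto simp: C_iff)
    qed
    ultimately show ?thesis by blast
  next
    case True
    then have pz: "prim z" and zt: "below (phi z) t"
      using z below_trans by blast+
    note vz = prim_vecs[OF pz]
    obtain u where u: "u \<in> vecs" "phi (z + u) = t" "z + u \<in> vecs"
      using below_ex_add[OF zt vz] by metis
    have c: "z + u \<in> C"
      using u prim_add_not_prim[OF pz u(1)] by (cases "u = 0") (auto simp: C_iff)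
    moreover have "(x, z + u) \<in> ?R" if x: "x \<in> C" for x
    proof (cases "x = z + u")
      case False
      then obtain p where p: "prim p" "p \<le> x"
        using ex_prim_le[of x "z + u"] x u by (auto simp: C_iff)
      then have pt: "below (phi p) t" using below_phi x by (auto simp: C_iff)
      define v where "v = x - p"
      have xv: "x = p + v" "v \<in> vecs"
        using p x fun_le_diff_add[OF p(2)] by (auto simp: v_def C_iff vecs_diff add.commute)
      show ?thesis
      proof (cases "v = 0")
        case True
        then have "x = z" using x p xv by (auto simp: C_iff)
        then have "phi u = 0" using x u by (auto simp: C_iff phi_add)
        then have "u = 0" using u phi_eq_0 by blast
        then show ?thesis using False \<open>x = z\<close> by simp
      next
        case v: False
        \<comment> \<open>Exchange \<open>p\<close> for \<open>z + w\<close> inside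
          \<open>x = p + v\<close>. The result shares \<open>v\<close> with \<open>x\<close> and
          \<open>z\<close> with the hub, giving a path of length at most two.\<close>
        obtain w where w: "w \<in> vecs" "phi (z + w) = phi p" "z + w \<in> vecs"
          using below_ex_add[OF _ vz] z p pt by metis
        have zwv: "z + w + v \<in> vecs" "phi (z + w + v) = t"
          using w xv x by (simp_all add: vecs_add phi_add C_iff)
        have "\<not> disj_supp x (z + w + v)"
          using v unfolding xv(1) disj_supp_def by (auto simp: fun_eq_iff)
        then have "(x, z + w + v) \<in> ?R"
          using x zwv by (cases "x = z + w + v") (auto simp only: fact_adj_iff C_iff)
        moreover have "\<not> disj_supp (z + w + v) (z + u)"
          using prim_nonzero[OF pz] unfolding disj_supp_def by (auto simp: fun_eq_iff)
        then have "(z + w + v, z + u) \<in> ?R"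
          using zwv u by (cases "z + w + v = z + u") (auto simp only: fact_adj_iff)
        ultimately show ?thesis by (rule rtrancl_trans)
      qed
    qed simp
    ultimately show ?thesis by blast
  qed
  then obtain c where c: "c \<in> C" "\<And>x. x \<in> C \<Longrightarrow> (x, c) \<in> ?R" by blast
  have C_class: "?R `` {x} = C" if "x \<in> C" for x
  proof
    show "C \<subseteq> ?R `` {x}"
    proof
      fix y assume "y \<in> C"
      then have "(c, y) \<in> ?R" using c(2) sym_fact_adj symD by metis
      then show "y \<in> ?R `` {x}" using rtrancl_trans[OF c(2)[OF that]] by blast
    qed
  qed (rule class_sub[OF that])
  have "factorizations S t = P \<union> C"
    by (auto simp: C_def P_def factorizations_iff prim_vecs)
  then have "R_classes S t = (\<Union>x\<in>P. {?R `` {x}}) \<union> (\<Union>x\<in>C. {?R `` {x}})"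
    by (simp add: R_classes_def quotient_def)
  also have "\<dots> = insert C ((\<lambda>p. {p}) ` P)"
    using c(1) by (auto simp: P_class C_class)
  finally have "R_classes S t = insert C ((\<lambda>p. {p}) ` P)" .
  moreover have "C \<notin> (\<lambda>p. {p}) ` P" by (auto simp: C_def)
  moreover have "finite P"
    by (rule finite_subset[OF _ finite_factorizations[of t]])
      (auto simp: P_def factorizations_iff prim_vecs)
  ultimately show ?thesis
    by (simp add: nc_def P_def[symmetric] card_image)
qed

section \<open>Unique normal forms\<close>

text \<open>A unique factorization lies above no \<open>y\<close> in \<open>Y\<close>, since
  exchanging \<open>y\<close> for another factorization of its degree would give a second one.
  Otherwise the only isolated vector below a normal form is \<open>z\<close>. Subtracting
  \<open>z\<close> leads to normal forms of \<open>t - phi z\<close>, and adding it back is harmless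
  because \<open>z\<close> is disjoint from \<open>Y\<close>.\<close>

lemma ex1_normal_form:
  assumes z: "\<And>p. prim p \<Longrightarrow> below (phi p) s \<Longrightarrow> prim z \<and> below (phi z) (phi p)"
    and Y: "Y = {p. prim p \<and> below (phi p) s \<and> p \<noteq> z}"
    and t: "t \<in> S" "below t s"
  shows "\<exists>!x. x \<in> factorizations S t \<and> (\<forall>y\<in>Y. \<not> y \<le> x)"
  using t
proof (induction t rule: less_induct)
  case (less t)
  note ts = less.prems(2)
  show ?case
  proof (cases "\<exists>x y. x \<in> vecs \<and> y \<in> vecs \<and> x \<noteq> y \<and> phi x = t \<and> phi y = t")
    case False
    obtain x where x: "x \<in> vecs" "phi x = t" using ex_factorization less.prems by blast
    have "\<not> y \<le> x" if "y \<in> Y" for y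
    proof
      assume yx: "y \<le> x"
      have "prim y" using that Y by simp
      then obtain y' where y': "y' \<in> vecs" "phi y' = phi y" "y' \<noteq> y"
        using prim_alternative by blast
      have "phi (x - y + y') = phi (x - y + y)" by (simp only: phi_add y'(2))
      then have "phi (x - y + y') = t" using x yx by (simp add: fun_le_diff_add)
      moreover have "x - y + y' \<noteq> x"
        using y'(3) fun_le_diff_add[OF yx] by (metis add_left_cancel)
      ultimately show False using False x y' by (metis vecs_add vecs_diff)
    qed
    then show ?thesis using x False by (auto simp: factorizations_iff)
  next
    case True
    then obtain x0 y0 where xy0: "x0 \<in> vecs" "y0 \<in> vecs" "x0 \<noteq> y0" "phi x0 = t" "phi y0 = t"
      by blast
    obtain p where p: "prim p" "p \<le> x0" using ex_prim_le xy0 by metis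
    then have "below (phi p) t" using below_phi xy0 by blast
    then have pz: "prim z" and zt: "below (phi z) t"
      using z[OF p(1)] ts below_trans by blast+
    have tz: "t - phi z < t" "t - phi z \<in> S" "below (t - phi z) s" "phi z \<le> t"
      using zt prim_phi_pos[OF pz] below_diff[OF phi_in_S zt ts] by (auto simp: below_def)
    obtain w where w: "w \<in> factorizations S (t - phi z)" "\<And>y. y \<in> Y \<Longrightarrow> \<not> y \<le> w"
      and w_unique: "\<And>w'. w' \<in> factorizations S (t - phi z) \<Longrightarrow> (\<And>y. y \<in> Y \<Longrightarrow> \<not> y \<le> w') \<Longrightarrow> w' = w"
      using less.IH[OF tz(1,2,3)] by metis
    show ?thesis
    proof (rule ex1I[of _ "w + z"], intro conjI ballI)
      show "w + z \<in> factorizations S t"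
        using w(1) tz(4) prim_vecs[OF pz] by (auto simp: factorizations_iff vecs_add phi_add)
      show "\<not> y \<le> w + z" if "y \<in> Y" for y
      proof -
        have "disj_supp y z"
          using that prim_disj_below[of z y] z[of y] disj_supp_sym by (auto simp: Y)
        then show ?thesis using disj_supp_le_add w(2)[OF that] by blast
      qed
    next
      fix x assume x: "x \<in> factorizations S t \<and> (\<forall>y\<in>Y. \<not> y \<le> x)"
      then have xv: "x \<in> vecs" "phi x = t" by (auto simp: factorizations_iff)
      then obtain y where "y \<in> vecs" "x \<noteq> y" "phi y = t"
        using xy0 by metis
      then obtain q where q: "prim q" "q \<le> x" using ex_prim_le[of x y] xv by auto
      then have "below (phi q) s" using below_phi[OF q(2)] xv ts below_trans by blast
      then have "q = z" using q x by (auto simp: Y)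
      then have zx: "z \<le> x" using q by simp
      have "x - z = w"
      proof (rule w_unique)
        show "x - z \<in> factorizations S (t - phi z)"
          using xv zx by (simp add: factorizations_iff vecs_diff phi_diff)
        fix y assume "y \<in> Y"
        then show "\<not> y \<le> x - z"
          using x order_trans[of y "x - z" x] by (auto simp: le_fun_def)
      qed
      then show "x = w + z" using fun_le_diff_add[OF zx] by simp
    qed
  qed
qed

section \<open>Exponents of the numerator of the Hilbert series\<close>

definition hilbert :: "int fps" where
  "hilbert = Abs_fps (\<lambda>n. if n \<in> S then 1 else 0)"

definition numerator :: "int fps" where
  "numerator = (\<Prod>n\<in>A. 1 - fps_X ^ n) * hilbert"

text \<open>The exponent of \<open>1 - X\<^bsup>j\<^esup>\<close> in the numerator of the Hilbert series.\<close>

definition adj_exp :: "nat \<Rightarrow> int" where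
  "adj_exp j = cyc_exp S j - (if j = 1 then 1 else 0) + (if j \<in> A then 1 else 0)"

lemma one_minus_X_power_supported: "n \<in> S \<Longrightarrow> i \<notin> S \<Longrightarrow> (1 - fps_X ^ n :: int fps) $ i = 0"
  using zero_S by (auto simp: fps_X_power_nth intro!: gr0I)

lemma prod_gens_supported: "i \<notin> S \<Longrightarrow> (\<Prod>n\<in>A. 1 - fps_X ^ n :: int fps) $ i = 0"
  by (rule fps_prod_supported[where S = S])
    (auto intro: zero_S add_S one_minus_X_power_supported mem_A)

lemma numerator_supported: "i \<notin> S \<Longrightarrow> numerator $ i = 0"
  unfolding numerator_def
  by (rule fps_mult_supported[where S = S])
    (auto intro: add_S prod_gens_supported simp: hilbert_def)

lemma numerator_nth_0: "numerator $ 0 = 1"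
  using prod_one_minus_X_power_nth_0[of A "\<lambda>n. n" "\<lambda>_. 1"] mem_A(2)
  by (simp add: numerator_def hilbert_def zero_S)

text \<open>The semigroup polynomial is \<open>(1 - X) * hilbert\<close>. Dividing out
  \<open>1 - X\<close> lowers the exponent at 1, and each generator raises its own by one; for
  \<open>S\<close> all of \<nat> the two corrections cancel.\<close>

lemma log_deriv_numerator: "log_deriv numerator (div_sum adj_exp)"
proof -
  let ?P = "semigroup_poly S"
  have P0: "?P $ 0 = 1" by (simp add: semigroup_poly_def zero_S)
  then have "?P \<noteq> 0" by auto
  then have "\<exists>!e. is_cyc_exp S e"
    using is_cyc_exp_exists[OF P0] is_cyc_exp_unique by metis
  then have "is_cyc_exp S (cyc_exp S)"
    unfolding cyc_exp_def by (rule theI')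
  then have "log_deriv ?P (div_sum (cyc_exp S))" by (rule cyc_exp_log_deriv)
  moreover have "?P = hilbert * (1 - fps_X)"
    by (simp add: semigroup_poly_def hilbert_def)
  moreover have "(1 - fps_X :: int fps) \<noteq> 0"
    by (metis diff_zero fps_X_nth fps_one_nth fps_sub_nth fps_zero_nth one_neq_zero zero_neq_one)
  ultimately have "log_deriv hilbert (div_sum (cyc_exp S) - div_sum (\<lambda>j. if j = 1 then 1 else 0))"
    using log_deriv_one_minus_X_power[of 1] by (intro log_deriv_cancel[where G = "1 - fps_X"]) auto
  moreover have "log_deriv (\<Prod>n\<in>A. 1 - fps_X ^ n) (\<Sum>n\<in>A. div_sum (\<lambda>j. if j = n then 1 else 0))"
    by (intro log_deriv_prod log_deriv_one_minus_X_power mem_A)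
  ultimately have "log_deriv numerator ((\<Sum>n\<in>A. div_sum (\<lambda>j. if j = n then 1 else 0))
      + (div_sum (cyc_exp S) - div_sum (\<lambda>j. if j = 1 then 1 else 0)))"
    unfolding numerator_def by (intro log_deriv_mult)
  also have "(\<Sum>n\<in>A. div_sum (\<lambda>j. if j = n then 1 else 0))
      + (div_sum (cyc_exp S) - div_sum (\<lambda>j. if j = 1 then 1 else 0)) = div_sum adj_exp"
    unfolding div_sum_sum div_sum_diff div_sum_add
    by (rule arg_cong[of _ _ div_sum]) (auto simp: adj_exp_def finite_A)
  finally show ?thesis .
qed

text \<open>The complement of \<open>S\<close> is stable under subtracting elements of
  \<open>S\<close> and under passing to divisors. The first property carries vanishing from the
  numerator to its logarithmic derivative, the second to the exponents.\<close>

lemma adj_exp_outside: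
  assumes "m \<notin> S"
  shows "adj_exp m = 0"
proof (rule div_sum_eq_0[where M = "- S"])
  fix n assume "n \<in> - S"
  show "div_sum adj_exp $ n = 0"
  proof (rule fps_cancel_vanish[where S = S and T = "- S" and F = numerator])
    show "k - i \<in> - S" if "k \<in> - S" "i \<in> S" "i \<le> k" for k i
      using add_S[of "k - i" i] that by auto
    show "(numerator * div_sum adj_exp) $ k = 0" if "k \<in> - S" for k
      unfolding log_deriv_numerator[unfolded log_deriv_def, symmetric]
      using that by (simp add: fps_X_deriv_nth numerator_supported)
  qed (use numerator_supported numerator_nth_0 \<open>n \<in> - S\<close> in auto)
next
  fix k j :: nat assume "k \<in> - S" "j dvd k"
  then show "j \<in> - S \<or> adj_exp j = 0"
    using mult_S by (auto elim!: dvdE simp: mult.commute)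
qed (use assms zero_S in \<open>auto intro!: gr0I\<close>)

lemma adj_exp_eq_card_prim:
  assumes z: "\<And>p. prim p \<Longrightarrow> below (phi p) s \<Longrightarrow> prim z \<and> below (phi z) (phi p)"
    and chain: "\<And>p q. prim p \<Longrightarrow> prim q \<Longrightarrow> below (phi p) s \<Longrightarrow> below (phi q) s \<Longrightarrow>
      below (phi p) (phi q) \<or> below (phi q) (phi p)"
    and s: "s \<in> S" "s > 0"
  shows "adj_exp s = int (card {p. prim p \<and> phi p = s \<and> p \<noteq> z})"
proof -
  define Y where "Y = {p. prim p \<and> below (phi p) s \<and> p \<noteq> z}"
  \<comment> \<open>\<open>T\<close> also contains numbers outside \<open>S\<close>. In this form it
    is stable under subtracting elements of \<open>S\<close>, so congruence on \<open>T\<close> is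
    respected by all series supported on \<open>S\<close>.\<close>
  define T where "T = {t. below t s}"
  define R :: "int fps" where "R = (\<Prod>y\<in>Y. 1 - fps_X ^ phi y)"
  \<comment> \<open>The exponent of \<open>1 - X^j\<close> in \<open>R\<close>.\<close>
  define h where "h = (\<lambda>j. int (card {y \<in> Y. phi y = j}))"
  have T_closed: "n - i \<in> T" if "n \<in> T" "i \<in> S" "i \<le> n" for n i
  proof -
    have ns: "n \<le> s" "s - n \<in> S" using that by (auto simp: T_def below_def)
    then have "s - (n - i) = (s - n) + i" "n - i \<le> s" using that by linarith+
    then show ?thesis using add_S[OF ns(2) that(2)] by (simp add: T_def below_def)
  qed
  have finY: "finite Y"
  proof (rule finite_subset)
    show "Y \<subseteq> (\<Union>t\<le>s. factorizations S t)"
      by (auto simp: Y_def factorizations_iff prim_vecs below_le)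
  qed (simp add: finite_factorizations)
  have "avoiders Y = avoiders {} * R"
    unfolding R_def
  proof (rule avoiders_eq[OF finY])
    show "pairwise disj_supp Y"
      using chain prim_disj_below disj_supp_sym unfolding pairwise_def Y_def by blast
  qed (auto simp: Y_def prim_vecs)
  then have "(\<Prod>n\<in>A. 1 - fps_X ^ n) * avoiders Y = (avoiders {} * (\<Prod>n\<in>A. 1 - fps_X ^ n)) * R"
    by (simp add: ac_simps)
  then have R_eq: "(\<Prod>n\<in>A. 1 - fps_X ^ n) * avoiders Y = R"
    by (simp add: avoiders_empty)
  have "hilbert $ t = avoiders Y $ t" if "t \<in> T" for t
  proof (cases "t \<in> S")
    case True
    have "below t s" using that by (simp add: T_def)
    with True have "\<exists>!x. x \<in> factorizations S t \<and> (\<forall>y\<in>Y. \<not> y \<le> x)"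
      by (rule ex1_normal_form[OF z Y_def, rotated -2])
    then obtain x where "{x \<in> factorizations S t. \<forall>y\<in>Y. \<not> y \<le> x} = {x}"
      by (elim ex1E) (rule that, blast)
    then have "card {x \<in> factorizations S t. \<forall>y\<in>Y. \<not> y \<le> x} = 1"
      by simp
    then show ?thesis using True by (simp add: hilbert_def avoiders_def)
  next
    case False
    then have "factorizations S t = {}" using phi_in_S by (auto simp: factorizations_iff)
    then show ?thesis using False by (simp add: hilbert_def avoiders_def)
  qed
  then have "((\<Prod>n\<in>A. 1 - fps_X ^ n) * (hilbert - avoiders Y)) $ t = 0" if "t \<in> T" for t
    using that T_closed prod_gens_supported
    by (intro fps_mult_vanish[where S = S and T = T]) auto
  then have KR: "(numerator - R) $ t = 0" if "t \<in> T" for t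
    using that unfolding right_diff_distrib R_eq numerator_def by blast
  have LR: "log_deriv R (div_sum h)"
  proof -
    have "log_deriv R (\<Sum>y\<in>Y. div_sum (\<lambda>j. if j = phi y then 1 else 0))"
      unfolding R_def
      by (intro log_deriv_prod log_deriv_one_minus_X_power prim_phi_pos) (simp add: Y_def)
    moreover have "(\<Sum>y\<in>Y. if j = phi y then 1 else 0) = h j" for j
      using finY by (simp add: h_def sum.If_cases Int_def eq_commute)
    ultimately show ?thesis by (simp add: div_sum_sum)
  qed
  have h_outside: "h j = 0" if "j \<notin> S" for j
  proof -
    have "{y \<in> Y. phi y = j} = {}" using that phi_in_S by blast
    then show ?thesis by (simp only: h_def card.empty of_nat_0)
  qed
  have div_sum_h_outside: "div_sum h $ j = 0" if "j \<notin> S" for j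
    unfolding div_sum_def fps_nth_Abs_fps
  proof (rule sum.neutral, rule ballI)
    fix i assume "i \<in> {i. i \<in> {1..j} \<and> i dvd j}"
    then have "i \<notin> S" using that mult_S by (auto elim!: dvdE simp: mult.commute)
    then show "int i * h i = 0" by (simp add: h_outside)
  qed
  \<comment> \<open>The difference of the logarithmic derivatives, times the unit
    \<open>numerator\<close>, is governed by \<open>numerator - R\<close>, which vanishes on
    \<open>T\<close>.\<close>
  have "numerator * (div_sum adj_exp - div_sum h)
      = - (fps_X * fps_deriv (numerator - R)) - div_sum h * (numerator - R)"
  proof -
    have "numerator * (div_sum adj_exp - div_sum h)
        = numerator * div_sum adj_exp - R * div_sum h - div_sum h * (numerator - R)"
      by (simp add: algebra_simps)
    also have "numerator * div_sum adj_exp - R * div_sum h = - (fps_X * fps_deriv (numerator - R))"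
      unfolding LR[unfolded log_deriv_def, symmetric] log_deriv_numerator[unfolded log_deriv_def, symmetric]
      by (simp add: algebra_simps)
    finally show ?thesis .
  qed
  moreover have "(- (fps_X * fps_deriv (numerator - R)) - div_sum h * (numerator - R)) $ t = 0"
    if "t \<in> T" for t
    unfolding fps_sub_nth[of "- _"] fps_neg_nth fps_X_deriv_nth KR[OF that]
    using fps_mult_vanish[OF div_sum_h_outside T_closed KR that] by simp
  ultimately have vanish: "(div_sum adj_exp - div_sum h) $ t = 0" if "t \<in> T" for t
    by (intro fps_cancel_vanish[OF numerator_supported numerator_nth_0 T_closed _ that]) simp_all
  have "adj_exp s - h s = 0"
  \<comment> \<open>A divisor of \<open>m\<close> that lies in \<open>S\<close> is below
    \<open>m\<close>, because the difference is again a multiple of it; at a divisor outside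
    \<open>S\<close> both exponents vanish.\<close>
  proof (rule div_sum_eq_0[where M = "S \<inter> T" and f = "\<lambda>j. adj_exp j - h j"])
    show "div_sum (\<lambda>j. adj_exp j - h j) $ m = 0" if "m \<in> S \<inter> T" for m
      using vanish[of m] that by (simp only: div_sum_diff) simp
    show "j \<in> S \<inter> T \<or> adj_exp j - h j = 0" if m: "m \<in> S \<inter> T" "j < m" "j dvd m" for m j
    proof (cases "j \<in> S")
      case True
      obtain k where k: "m = j * k" using m by blast
      then have "m - j = (k - 1) * j" by (simp add: diff_mult_distrib2 mult.commute)
      then have "m - j \<in> S" using mult_S[OF True] by simp
      then have "below j m" using m by (simp add: below_def)
      then show ?thesis using m True below_trans by (auto simp: T_def)
    qed (simp add: adj_exp_outside h_outside)
  qed (use s below_refl in \<open>auto simp: T_def\<close>)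
  moreover have "{y \<in> Y. phi y = s} = {p. prim p \<and> phi p = s \<and> p \<noteq> z}"
    using below_refl by (auto simp: Y_def)
  ultimately show ?thesis by (simp add: h_def)
qed

section \<open>Comparing Betti elements and nonzero exponents along chains\<close>

text \<open>The condition of \<open>U_set\<close> without membership of \<open>s\<close> in
  \<open>X\<close>, so that it can be compared for \<open>Betti S\<close> and \<open>calE S\<close>
  at the same \<open>s\<close>.\<close>

definition chain_below :: "nat set \<Rightarrow> nat \<Rightarrow> bool" where
  "chain_below X s \<longleftrightarrow> (\<forall>y\<in>X. \<forall>z\<in>X. below y s \<longrightarrow> below z s \<longrightarrow> below y z \<or> below z y)"

lemma chain_below_mono: "chain_below X s \<Longrightarrow> below t s \<Longrightarrow> chain_below X t"
  unfolding chain_below_def using below_trans by blast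

lemma adj_exp_chain:
  assumes ch: "chain_below (Betti S) s" and s: "s \<in> S" "s > 0"
  shows "adj_exp s = int (nc S s) - 1"
proof -
  have chain: "below (phi p) (phi q) \<or> below (phi q) (phi p)"
    if "prim p" "prim q" "below (phi p) s" "below (phi q) s" for p q
    using ch that prim_Betti unfolding chain_below_def by blast
  \<comment> \<open>In a chain, an isolated vector of smallest degree has the least degree for
    \<open>below\<close> as well. If there is none below \<open>s\<close>, the requirement holds
    vacuously for any \<open>z\<close>.\<close>
  obtain z where z: "\<And>p. prim p \<Longrightarrow> below (phi p) s \<Longrightarrow> prim z \<and> below (phi z) (phi p)"
  proof (cases "\<exists>p. prim p \<and> below (phi p) s")
    case True
    then obtain z where z: "prim z" "below (phi z) s"
      "\<And>p. prim p \<and> below (phi p) s \<Longrightarrow> phi z \<le> phi p"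
      using ex_has_least_nat[of "\<lambda>p. prim p \<and> below (phi p) s" _ phi] by blast
    have "below (phi z) (phi p)" if "prim p" "below (phi p) s" for p
      using chain[OF z(1) that(1) z(2) that(2)] z(3)[of p] that below_le below_refl
      by (metis le_antisym)
    then show ?thesis using that z(1) by blast
  qed (use that in blast)
  show ?thesis
    using adj_exp_eq_card_prim[OF z chain s] nc_eq_card_prim[OF z s(1)] by simp
qed

text \<open>Removing one generator from \<open>x\<close> writes \<open>phi x\<close> as a sum of two
  semigroup elements, so minimality forces the rest to be zero.\<close>

lemma factorization_of_gen:
  assumes "x \<in> vecs" "phi x \<in> A"
  shows "x = unit_vec (phi x)"
proof -
  have "x \<noteq> 0" using assms(2) mem_A(2) phi_zero by (metis less_irrefl)
  then obtain n where n: "x n > 0" by (auto simp: fun_eq_iff)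
  then have nA: "n \<in> A" using assms(1) by (auto simp: vecs_def)
  have u: "x - unit_vec n + unit_vec n = x" using n by (simp add: fun_le_diff_add unit_vec_le)
  then have eq: "phi x = phi (x - unit_vec n) + n"
    using phi_add phi_unit_vec[OF nA] by metis
  then have "phi (x - unit_vec n) = 0"
    using assms(2) mem_A[OF nA] phi_in_S[of "x - unit_vec n"]
    unfolding min_gens_def by blast
  then have "x - unit_vec n = 0" using phi_eq_0[OF vecs_diff] assms by blast
  then show ?thesis using u eq by (simp add: phi_zero)
qed

lemma Betti_not_gen: "b \<in> Betti S \<Longrightarrow> b \<notin> A"
  using Betti_nonunique factorization_of_gen by metis

lemma Betti_ge_2:
  assumes b: "b \<in> Betti S"
  shows "b \<ge> 2"
proof -
  have "b \<noteq> 0" using Betti_nonunique[OF b] phi_eq_0 by metis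
  moreover have "b \<noteq> 1"
  proof
    assume "b = 1"
    then have "1 \<in> A" using b by (auto simp: Betti_def min_gens_def)
    then show False using b Betti_not_gen \<open>b = 1\<close> by blast
  qed
  ultimately show ?thesis by simp
qed

lemma cyc_exp_Betti:
  assumes "chain_below (Betti S) b" "b \<in> Betti S"
  shows "cyc_exp S b = int (nc S b) - 1"
  using adj_exp_chain[OF assms(1)] assms(2) Betti_ge_2[OF assms(2)] Betti_not_gen[OF assms(2)]
  by (auto simp: adj_exp_def Betti_def)

lemma nc_pos: "s \<in> S \<Longrightarrow> nc S s > 0"
  using ex_factorization[of s] R_classes_I finite_R_classes
  by (auto simp: nc_def card_gt_0_iff)

text \<open>For \<open>s\<close> at least 2 that is no generator, \<open>cyc_exp\<close> and
  \<open>adj_exp\<close> agree. On a chain their value is one less than the number of classes, hence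
  nonzero exactly for Betti elements.\<close>

lemma calE_iff_Betti:
  assumes ch: "chain_below (Betti S) s"
  shows "s \<in> calE S \<longleftrightarrow> s \<in> Betti S"
proof
  assume s: "s \<in> Betti S"
  then have "nc S s \<ge> 2" by (simp add: Betti_def nc_def)
  then show "s \<in> calE S"
    using cyc_exp_Betti[OF ch s] Betti_ge_2[OF s] Betti_not_gen[OF s]
    by (simp add: calE_def)
next
  assume s: "s \<in> calE S"
  then have adj: "adj_exp s \<noteq> 0" "s > 0" by (auto simp: adj_exp_def calE_def)
  then have "s \<in> S" using adj_exp_outside by blast
  then show "s \<in> Betti S"
    using adj_exp_chain[OF ch] adj nc_pos[of s] by (auto simp: Betti_def nc_def)
qed

text \<open>By induction, each Betti element strictly below \<open>s\<close> has a chain of Betti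
  elements below it and therefore lies in \<open>calE S\<close>, where comparability is given. The
  element \<open>s\<close> itself is comparable with everything below it.\<close>

lemma chain_below_Betti_if_calE:
  assumes d: "chain_below (calE S) d" and "below s d"
  shows "chain_below (Betti S) s"
  using assms(2)
proof (induction s rule: less_induct)
  case (less s)
  have E: "y \<in> calE S" if "y \<in> Betti S" "below y s" "y \<noteq> s" for y
    using less.IH[of y] that less.prems below_trans[of y s d] below_le[of y s] calE_iff_Betti
    by auto
  show ?case
    unfolding chain_below_def
  proof (intro ballI impI)
    fix y z assume yz: "y \<in> Betti S" "z \<in> Betti S" "below y s" "below z s"
    show "below y z \<or> below z y"
    proof (cases "y = s \<or> z = s")
      case False
      then show ?thesis
        using E yz d below_trans less.prems unfolding chain_below_def by blast
    qed (use yz in auto)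
  qed
qed

lemma chain_below_Betti_iff_calE: "chain_below (Betti S) d \<longleftrightarrow> chain_below (calE S) d"
proof
  assume ch: "chain_below (Betti S) d"
  then have "y \<in> Betti S" if "y \<in> calE S" "below y d" for y
    using calE_iff_Betti[OF chain_below_mono[OF ch that(2)]] that(1) by simp
  then show "chain_below (calE S) d"
    using ch unfolding chain_below_def by blast
qed (rule chain_below_Betti_if_calE[OF _ below_refl])

lemma U_set_eq: "U_set (\<lambda>a b. le_S S (int a) (int b)) X = {x \<in> X. chain_below X x}"
  by (simp add: U_set_def le_S_iff_below chain_below_def)

end

theorem theorem1p2:
  fixes S :: "nat set"
  assumes "numerical_semigroup S"
  shows "U_set (\<lambda>a b. le_S S (int a) (int b)) (Betti S) = U_set (\<lambda>a b. le_S S (int a) (int b)) (calE S)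
     \<and> (\<forall>b\<in>U_set (\<lambda>a b. le_S S (int a) (int b)) (Betti S). cyc_exp S b = int (nc S b) - 1)"
proof -
  interpret num_semigroup S by unfold_locales (rule assms)
  have "{b \<in> Betti S. chain_below (Betti S) b} = {d \<in> calE S. chain_below (calE S) d}"
    using calE_iff_Betti chain_below_Betti_iff_calE by blast
  then show ?thesis
    unfolding U_set_eq using cyc_exp_Betti by blast
qed

end
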